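(* If $n_1 \ge 2$ and $n_2 \ge 2$, then $\mathrm{ip}(K_{n_1} \Box K_{n_2}) = \lceil n_1 n_2/3 \rceil$.
   Context: An isometric path between two vertices of a graph is a shortest path joining them. The isometric path number $\mathrm{ip}(G)$ of a graph $G$ is the minimum number of isometric paths needed to cover all vertices of $G$. $K_m$ denotes the complete graph on $m$ vertices. The Cartesian product $K_{n_1} \Box \cdots \Box K_{n_r}$ has vertex set $\{(x_1,\ldots,x_r) : 0 \le x_i < n_i\}$, with two vertices adjacent if and only if they differ in exactly one coordinate. *)

theory Defs
  imports Complex_Main "Graph_Theory.Graph_Theory"
begin

text \<open>
  Undirected graphs are symmetric digraphs, as in the locale \<^locale>\<open>graph\<close>: an edge is a
  pair of opposite arcs. A path is given by its first vertex and its list of arcs, so a trivial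
  path (a single vertex, no arcs) is allowed.
\<close>

context pre_digraph
begin

definition isometric_path :: "'a \<Rightarrow> 'b awalk \<Rightarrow> 'a \<Rightarrow> bool" where
  "isometric_path u p v \<longleftrightarrow> apath u p v \<and> (\<forall>q. apath u q v \<longrightarrow> length p \<le> length q)"

definition isometric_path_cover :: "('a \<times> 'b awalk) set \<Rightarrow> bool" where
  "isometric_path_cover P \<longleftrightarrow>
     (\<forall>(u, p) \<in> P. \<exists>v. isometric_path u p v) \<and>
     (\<Union>(u, p) \<in> P. set (awalk_verts u p)) = verts G"

text \<open>
  The two orientations of a path are different elements of a cover; this does not affect the
  minimum, since a minimum cover never needs both.
\<close>

definition isometric_path_number :: nat where
  "isometric_path_number = (LEAST k. \<exists>P. finite P \<and> card P = k \<and> isometric_path_cover P)"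

end

lemma (in fin_digraph) isometric_path_number_attained:
  "\<exists>P. finite P \<and> card P = isometric_path_number \<and> isometric_path_cover P"
proof -
  let ?P = "(\<lambda>v. (v, [])) ` verts G :: ('a \<times> 'b awalk) set"
  have "isometric_path v [] v" if "v \<in> verts G" for v
    using that by (simp add: isometric_path_def apath_def awalk_def)
  then have "isometric_path_cover ?P"
    unfolding isometric_path_cover_def by auto
  then have "\<exists>P. finite P \<and> card P = card ?P \<and> isometric_path_cover P"
    by (intro exI[of _ ?P] conjI refl finite_imageI finite_verts)
  then show ?thesis
    unfolding isometric_path_number_def by (rule LeastI)
qed

text \<open>
  The product of the complete graphs on \<open>ns ! 0, ns ! 1, \<dots>\<close> vertices; a vertex is the list of
  its coordinates.
\<close>

definition complete_graph_product :: "nat list \<Rightarrow> nat list pair_pre_digraph" where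
  "complete_graph_product ns =
     (let V = {xs. length xs = length ns \<and> (\<forall>i < length ns. xs ! i < ns ! i)}
      in \<lparr>pverts = V,
          parcs = {(xs, ys). xs \<in> V \<and> ys \<in> V \<and> (\<exists>!i. i < length ns \<and> xs ! i \<noteq> ys ! i)}\<rparr>)"

lemma pair_graph_complete_graph_product: "pair_graph (complete_graph_product ns)"
proof -
  let ?G = "complete_graph_product ns"
  let ?m = "Max (insert 0 (set ns))"
  have "xs ! i < ?m" if "xs \<in> pverts ?G" "i < length ns" for xs i
  proof -
    have "xs ! i < ns ! i" using that by (simp add: complete_graph_product_def Let_def)
    also have "ns ! i \<le> ?m" using that by simp
    finally show ?thesis .
  qed
  then have "pverts ?G \<subseteq> {xs. set xs \<subseteq> {..<?m} \<and> length xs = length ns}"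
    by (auto simp: complete_graph_product_def Let_def in_set_conv_nth simp del: Max_insert)
  then have V: "finite (pverts ?G)"
    by (rule finite_subset) (simp add: finite_lists_length_eq)
  have "parcs ?G \<subseteq> pverts ?G \<times> pverts ?G"
    by (auto simp: complete_graph_product_def Let_def)
  then have A: "finite (parcs ?G)"
    by (rule finite_subset) (simp add: V)
  have swap: "(\<lambda>i. i < length ns \<and> ys ! i \<noteq> xs ! i) = (\<lambda>i. i < length ns \<and> xs ! i \<noteq> ys ! i)"
    for xs ys :: "nat list"
    by (rule ext) (rule conj_cong, rule refl, rule neq_commute)
  have S: "sym (parcs ?G)"
  proof (rule symI)
    fix xs ys assume "(xs, ys) \<in> parcs ?G"
    then show "(ys, xs) \<in> parcs ?G"
      unfolding complete_graph_product_def Let_def pair_pre_digraph.select_convs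
        mem_Collect_eq case_prod_conv swap[of ys xs] by blast
  qed
  have E: "xs \<in> pverts ?G \<and> ys \<in> pverts ?G \<and> xs \<noteq> ys" if "(xs, ys) \<in> parcs ?G" for xs ys
    using that unfolding complete_graph_product_def Let_def pair_pre_digraph.select_convs
      mem_Collect_eq case_prod_conv by blast
  show ?thesis
  proof
    show "symmetric (with_proj ?G)" by (simp add: symmetric_def S)
    show "fst e \<in> pverts ?G" "snd e \<in> pverts ?G" "fst e \<noteq> snd e" if "e \<in> parcs ?G" for e
      using E[of "fst e" "snd e"] that by simp_all
  qed (fact V A)+
qed

end

theory Submission
  imports Defs
begin

text \<open>
  The product has diameter at most 2, so an isometric path covers at most three vertices, which
  gives the lower bound. Conversely any \<open>{(a, b), (a, d), (c, d)}\<close> is the vertex set of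
  an isometric path. Grids of size \<open>2 \<times> 3\<close> and \<open>3 \<times> 3\<close> are partitioned by two
  and three such triples; stacking them, three columns of height \<open>m \<ge> 2\<close> need exactly
  \<open>m\<close> paths. Removing triples of columns and of rows leaves a dimension 0 or sides in
  \<open>{2, 4}\<close>, and the latter reduce to \<open>2 \<times> 2\<close>, \<open>2 \<times> 1\<close> and
  \<open>4 \<times> 1\<close>.
\<close>

section \<open>Covering a rectangle by corners\<close>

text \<open>The quadruple gives the two ends; the turn is at \<open>(a, d)\<close>. Equalities
  \<open>a = c\<close> or \<open>b = d\<close> are allowed, so pairs in a line and single points are
  degenerate corners.\<close>

definition corner :: "'a \<times> 'b \<times> 'a \<times> 'b \<Rightarrow> ('a \<times> 'b) set" where
  "corner = (\<lambda>(a, b, c, d). {(a, b), (a, d), (c, d)})"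

text \<open>Arbitrary sets replace initial segments so that what remains after removing rows or
  columns is again a rectangle. Corners may overlap.\<close>

definition corner_coverable :: "'a set \<Rightarrow> 'b set \<Rightarrow> nat \<Rightarrow> bool" where
  "corner_coverable A B k \<longleftrightarrow> (\<exists>Q. finite Q \<and> card Q \<le> k \<and> \<Union> (corner ` Q) = A \<times> B)"

lemma corner_coverable_list:
  assumes "\<Union> (corner ` set qs) = A \<times> B" "length qs \<le> k"
  shows "corner_coverable A B k"
  using assms card_length[of qs] unfolding corner_coverable_def
  by (intro exI[of _ "set qs"]) auto

lemma corner_coverable_swap:
  assumes "corner_coverable A B k"
  shows "corner_coverable B A k"
proof -
  obtain Q where Q: "finite Q" "card Q \<le> k" "\<Union> (corner ` Q) = A \<times> B"
    using assms unfolding corner_coverable_def by blast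
  \<comment> \<open>Transposition alone would move the turn to the wrong kind of position; reading
    the path from its other end restores the form required by \<open>corner\<close>.\<close>
  let ?f = "\<lambda>(a, b, c, d). (d, c, b, a)"
  have "\<Union> (corner ` ?f ` Q) = prod.swap ` \<Union> (corner ` Q)"
    by (force simp: image_UN image_image corner_def case_prod_unfold insert_commute)
  also have "\<dots> = B \<times> A"
    unfolding Q(3) by (rule product_swap)
  finally show ?thesis
    unfolding corner_coverable_def
    using Q(1,2) card_image_le[of Q ?f] by (intro exI[of _ "?f ` Q"]) auto
qed

lemma corner_coverable_Un:
  assumes "corner_coverable A B k" "corner_coverable A' B k'"
  shows "corner_coverable (A \<union> A') B (k + k')"
proof -
  obtain Q Q' where Q: "finite Q" "card Q \<le> k" "\<Union> (corner ` Q) = A \<times> B"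
    and Q': "finite Q'" "card Q' \<le> k'" "\<Union> (corner ` Q') = A' \<times> B"
    using assms unfolding corner_coverable_def by blast
  have "card (Q \<union> Q') \<le> k + k'"
    using card_Un_le[of Q Q'] Q(2) Q'(2) by linarith
  moreover have "\<Union> (corner ` (Q \<union> Q')) = (A \<union> A') \<times> B"
    using Q(3) Q'(3) by (simp add: image_Un Sigma_Un_distrib1)
  ultimately show ?thesis
    unfolding corner_coverable_def using Q(1) Q'(1) by blast
qed

lemma corner_coverable_2_3:
  assumes "card A = 2" "card B = 3"
  shows "corner_coverable A B 2"
proof -
  obtain a0 a1 where A: "A = {a0, a1}" using assms(1) by (auto simp: card_2_iff)
  obtain b0 b1 b2 where B: "B = {b0, b1, b2}" using assms(2) by (auto simp: card_3_iff)
  show ?thesis unfolding A B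
    by (rule corner_coverable_list[of "[(a0, b0, a1, b1), (a1, b0, a0, b2)]"])
      (auto simp: corner_def)
qed

lemma corner_coverable_3_3:
  assumes "card A = 3" "card B = 3"
  shows "corner_coverable A B 3"
proof -
  obtain a0 a1 a2 where A: "A = {a0, a1, a2}" using assms(1) by (auto simp: card_3_iff)
  obtain b0 b1 b2 where B: "B = {b0, b1, b2}" using assms(2) by (auto simp: card_3_iff)
  show ?thesis unfolding A B
    \<comment> \<open>The turns lie on the diagonal: with indices modulo 3, the corner turning at
      \<open>(ai, bi)\<close> ends one step to the right and one step down.\<close>
    by (rule corner_coverable_list[of
          "[(a0, b1, a1, b0), (a1, b2, a2, b1), (a2, b0, a0, b2)]"])
      (auto simp: corner_def)
qed

lemma corner_coverable_three_columns:
  assumes "2 \<le> card A" "card B = 3"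
  shows "corner_coverable A B (card A)"
  using assms(1)
proof (induction "card A" arbitrary: A rule: less_induct)
  case less
  \<comment> \<open>An infinite set has \<open>card\<close> 0, which contradicts the lower bound
    2.\<close>
  have fin: "finite A" using less.prems card.infinite by fastforce
  consider "card A = 2" | "card A = 3" | "card A \<ge> 4" using less.prems by linarith
  then show ?case
  proof cases
    \<comment> \<open>Two rows are split off as a 2 by 3 block; at least two remain, as the
      induction hypothesis requires.\<close>
    case 3
    then obtain A' where A': "A' \<subseteq> A" "card A' = 2"
      using obtain_subset_with_card_n[of 2 A] by auto
    have card: "card (A - A') = card A - 2"
      using A' fin by (simp add: card_Diff_subset finite_subset)
    have "corner_coverable (A - A') B (card (A - A'))"
      using less.hyps[of "A - A'"] card 3 by simp
    with corner_coverable_2_3[OF A'(2) assms(2)]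
    have "corner_coverable (A' \<union> (A - A')) B (2 + card (A - A'))"
      by (rule corner_coverable_Un)
    moreover have "A' \<union> (A - A') = A" using A'(1) by blast
    moreover have "2 + card (A - A') = card A" using card 3 by linarith
    ultimately show ?thesis by simp
  qed (use corner_coverable_2_3[OF _ assms(2)] corner_coverable_3_3[OF _ assms(2)] in metis)+
qed

text \<open>\<open>(m * n + 2) div 3\<close> is the ceiling of \<open>m * n / 3\<close>.\<close>

definition optimally_coverable :: "nat \<Rightarrow> nat \<Rightarrow> bool" where
  "optimally_coverable m n \<longleftrightarrow>
     (\<forall>(A :: nat set) (B :: nat set). finite A \<longrightarrow> finite B \<longrightarrow> card A = m \<longrightarrow> card B = n \<longrightarrow>
        corner_coverable A B ((m * n + 2) div 3))"

lemma optimally_coverable_swap: "optimally_coverable m n \<Longrightarrow> optimally_coverable n m"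
  unfolding optimally_coverable_def by (metis corner_coverable_swap mult.commute)

text \<open>Three more columns raise the rounded bound by exactly \<open>m\<close>, which is also
  the cost of covering them, so nothing is lost by rounding.\<close>

lemma optimally_coverable_add3:
  assumes "2 \<le> m" "optimally_coverable m n"
  shows "optimally_coverable m (n + 3)"
  unfolding optimally_coverable_def
proof (intro allI impI)
  fix A B :: "nat set"
  assume *: "finite A" "finite B" "card A = m" "card B = n + 3"
  then obtain B' where B': "B' \<subseteq> B" "card B' = 3"
    using obtain_subset_with_card_n[of 3 B] by auto
  have "card (B - B') = n"
    using B' * by (simp add: card_Diff_subset finite_subset)
  \<comment> \<open>The factors are exchanged because \<open>corner_coverable_Un\<close> joins
    rectangles along the first factor.\<close>
  then have "corner_coverable (B - B') A ((m * n + 2) div 3)"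
    using assms(2) * unfolding optimally_coverable_def by (simp add: corner_coverable_swap)
  moreover have "corner_coverable B' A m"
    using corner_coverable_three_columns[of A B'] * B' assms(1) by (simp add: corner_coverable_swap)
  ultimately have "corner_coverable ((B - B') \<union> B') A ((m * n + 2) div 3 + m)"
    by (rule corner_coverable_Un)
  moreover have "(B - B') \<union> B' = B" using B'(1) by blast
  moreover have "(m * n + 2) div 3 + m = (m * (n + 3) + 2) div 3"
    by (simp add: algebra_simps)
  ultimately show "corner_coverable A B ((m * (n + 3) + 2) div 3)"
    by (simp add: corner_coverable_swap)
qed

lemma optimally_coverable_add_mult3:
  assumes "2 \<le> m" "optimally_coverable m n"
  shows "optimally_coverable m (n + 3 * j)"
proof (induction j)
  case (Suc j)
  from optimally_coverable_add3[OF assms(1) this] show ?case by (simp add: ac_simps)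
qed (simp add: assms(2))

lemma optimally_coverable_0: "optimally_coverable m 0"
  unfolding optimally_coverable_def
  by (auto intro!: corner_coverable_list[of "[]"])

text \<open>Inside a line a corner covers at most two points, yet lengths 2 and 4 still meet the
  rounded bound, so these strips can start the extension by three columns.\<close>

lemma optimally_coverable_2_1: "optimally_coverable 2 1"
  unfolding optimally_coverable_def
proof (intro allI impI)
  fix A B :: "nat set"
  assume "card A = 2" "card B = 1"
  then obtain a0 a1 b where AB: "A = {a0, a1}" "B = {b}"
    by (auto simp: card_2_iff card_1_singleton_iff)
  show "corner_coverable A B ((2 * 1 + 2) div 3)" unfolding AB
    by (rule corner_coverable_list[of "[(a0, b, a1, b)]"]) (auto simp: corner_def)
qed

lemma optimally_coverable_4_1: "optimally_coverable 4 1"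
  unfolding optimally_coverable_def
proof (intro allI impI)
  fix A B :: "nat set"
  assume "card A = 4" "card B = 1"
  then obtain a0 a1 a2 a3 b where AB: "A = {a0, a1, a2, a3}" "B = {b}"
    by (simp add: card_Suc_eq numeral_eq_Suc card_1_singleton_iff) blast
  show "corner_coverable A B ((4 * 1 + 2) div 3)" unfolding AB
    by (rule corner_coverable_list[of "[(a0, b, a1, b), (a2, b, a3, b)]"]) (auto simp: corner_def)
qed

lemma optimally_coverable_2_2: "optimally_coverable 2 2"
  unfolding optimally_coverable_def
proof (intro allI impI)
  fix A B :: "nat set"
  assume "card A = 2" "card B = 2"
  then obtain a0 a1 b0 b1 where AB: "A = {a0, a1}" "B = {b0, b1}"
    by (auto simp: card_2_iff)
  show "corner_coverable A B ((2 * 2 + 2) div 3)" unfolding AB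
    by (rule corner_coverable_list[of "[(a0, b0, a0, b1), (a1, b0, a1, b1)]"])
      (auto simp: corner_def)
qed

lemma optimally_coverable:
  assumes "2 \<le> m" "2 \<le> n"
  shows "optimally_coverable m n"
proof -
  have dvd: "optimally_coverable m n" if "2 \<le> m" "3 dvd n" for m n
    using that optimally_coverable_add_mult3[OF _ optimally_coverable_0, of m] by (auto elim!: dvdE)
  have 24: "optimally_coverable 2 4" and 44: "optimally_coverable 4 4"
    using optimally_coverable_add3[OF _ optimally_coverable_2_1]
      optimally_coverable_add3[OF _ optimally_coverable_4_1] by simp_all
  \<comment> \<open>Residue 1 is represented by 4 rather than 1, because extending the other side
    needs this side to be at least 2.\<close>
  have split: "\<exists>r j. k = r + 3 * j \<and> (r = 2 \<or> r = 4)" if "2 \<le> k" "\<not> 3 dvd k" for k :: nat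
    using that by presburger
  show ?thesis
  proof (cases "3 dvd m \<or> 3 dvd n")
    case True
    then show ?thesis using dvd assms optimally_coverable_swap by blast
  next
    case False
    then obtain r i s j where rs: "m = r + 3 * i" "r = 2 \<or> r = 4" "n = s + 3 * j" "s = 2 \<or> s = 4"
      using split assms by metis
    then have "optimally_coverable r s"
      using optimally_coverable_2_2 24 44 optimally_coverable_swap by blast
    then have "optimally_coverable r n"
      unfolding rs(3) using rs(2) by (intro optimally_coverable_add_mult3) auto
    then show ?thesis
      using optimally_coverable_add_mult3[OF assms(2) optimally_coverable_swap]
        optimally_coverable_swap rs(1) by blast
  qed
qed

section \<open>Isometric paths in a product of two complete graphs\<close>

abbreviation rook_graph :: "nat \<Rightarrow> nat \<Rightarrow> nat list pair_pre_digraph" where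
  "rook_graph m n \<equiv> complete_graph_product [m, n]"

lemma verts_rook_graph: "pverts (rook_graph m n) = (\<lambda>(a, b). [a, b]) ` ({..<m} \<times> {..<n})"
  by (auto simp: complete_graph_product_def less_Suc_eq length_Suc_conv)

lemma card_verts_rook_graph: "card (pverts (rook_graph m n)) = m * n"
  unfolding verts_rook_graph by (subst card_image) (auto simp: inj_on_def)

lemma arcs_rook_graph_iff:
  "([a, b], [c, d]) \<in> parcs (rook_graph m n) \<longleftrightarrow>
     a < m \<and> b < n \<and> c < m \<and> d < n \<and> (a = c \<longleftrightarrow> b \<noteq> d)"
  by (auto simp: complete_graph_product_def less_Suc_eq Ex1_def)

text \<open>The graph has no loops, so a move that changes nothing must be left out; the length is
  then the number of coordinates in which the ends differ.\<close>

fun corner_path :: "nat \<times> nat \<times> nat \<times> nat \<Rightarrow> nat list \<times> (nat list \<times> nat list) list" where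
  "corner_path (a, b, c, d) =
     ([a, b], (if b = d then [] else [([a, b], [a, d])]) @
              (if a = c then [] else [([a, d], [c, d])]))"

text \<open>A competitor without arcs forces equal ends, one with a single arc forces ends differing
  in one coordinate, and any other has at least the two arcs that a corner path can have.\<close>

lemma isometric_path_corner_path:
  assumes "a < m" "b < n" "c < m" "d < n"
  shows "pre_digraph.isometric_path (rook_graph m n) [a, b] (snd (corner_path (a, b, c, d))) [c, d]"
proof -
  interpret pair_graph "rook_graph m n" by (rule pair_graph_complete_graph_product)
  let ?p = "snd (corner_path (a, b, c, d))"
  have "length ?p \<le> length q" if "apath [a, b] q [c, d]" for q
  proof -
    have q: "awalk [a, b] q [c, d]" using that by (simp add: apath_def)
    show ?thesis
    proof (cases q)
      case Nil
      then show ?thesis using q by (auto simp: awalk_def)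
    next
      case (Cons e q')
      show ?thesis
      proof (cases q')
        case Nil
        then have "e = ([a, b], [c, d])" "e \<in> parcs (rook_graph m n)"
          using q Cons by (auto simp: awalk_def prod_eq_iff)
        then show ?thesis using Cons by (auto simp: arcs_rook_graph_iff)
      qed (use Cons in auto)
    qed
  qed
  moreover have "apath [a, b] ?p [c, d]"
    using assms by (auto simp: apath_def awalk_def arcs_rook_graph_iff verts_rook_graph)
  ultimately show ?thesis unfolding isometric_path_def by blast
qed

lemma pawalk_verts_corner_path:
  "set (pawalk_verts (fst (corner_path q)) (snd (corner_path q))) = (\<lambda>(a, b). [a, b]) ` corner q"
  by (cases q) (auto simp: corner_def)

text \<open>The corner path between the same ends has at most two arcs, so a shortest path has no
  more.\<close>

lemma card_pawalk_verts_isometric_path_le: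
  assumes "pre_digraph.isometric_path (rook_graph m n) u p v"
  shows "card (set (pawalk_verts u p)) \<le> 3"
proof -
  interpret pair_graph "rook_graph m n" by (rule pair_graph_complete_graph_product)
  have p: "apath u p v" "\<And>q. apath u q v \<Longrightarrow> length p \<le> length q"
    using assms by (auto simp: isometric_path_def)
  then have "u \<in> pverts (rook_graph m n)" "v \<in> pverts (rook_graph m n)"
    using awalk_hd_in_verts awalk_last_in_verts by (auto simp: apath_def)
  then obtain a b c d where uv: "u = [a, b]" "v = [c, d]" "a < m" "b < n" "c < m" "d < n"
    by (auto simp: verts_rook_graph)
  then have "apath u (snd (corner_path (a, b, c, d))) v"
    using isometric_path_corner_path[of a m b n c d] by (simp only: isometric_path_def)
  then have "length p \<le> length (snd (corner_path (a, b, c, d)))" by (rule p(2))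
  also have "\<dots> \<le> 2" by simp
  finally have "length (pawalk_verts u p) \<le> 3" by (simp add: length_awalk_verts)
  then show ?thesis using card_length[of "pawalk_verts u p"] by linarith
qed

lemma rook_graph_le_isometric_path_number:
  "m * n \<le> 3 * pre_digraph.isometric_path_number (rook_graph m n)"
proof -
  interpret pair_graph "rook_graph m n" by (rule pair_graph_complete_graph_product)
  obtain P where P: "finite P" "card P = isometric_path_number" "isometric_path_cover P"
    using isometric_path_number_attained by blast
  let ?V = "\<lambda>(u, p). set (pawalk_verts u p)"
  have "m * n = card (\<Union> (?V ` P))"
    using P(3) card_verts_rook_graph[of m n] by (simp add: isometric_path_cover_def)
  also have "\<dots> \<le> (\<Sum>x\<in>P. card (?V x))" by (rule card_UN_le) (fact P(1))
  also have "\<dots> \<le> (\<Sum>x\<in>P. 3)"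
    using P(3) card_pawalk_verts_isometric_path_le
    by (intro sum_mono) (fastforce simp: isometric_path_cover_def)
  finally show ?thesis using P(2) by simp
qed

lemma rook_graph_isometric_path_number_le:
  assumes "corner_coverable {..<m} {..<n} k"
  shows "pre_digraph.isometric_path_number (rook_graph m n) \<le> k"
proof -
  interpret pair_graph "rook_graph m n" by (rule pair_graph_complete_graph_product)
  obtain Q where Q: "finite Q" "card Q \<le> k" "\<Union> (corner ` Q) = {..<m} \<times> {..<n}"
    using assms unfolding corner_coverable_def by blast
  have "\<exists>v. isometric_path (fst (corner_path q)) (snd (corner_path q)) v" if "q \<in> Q" for q
  proof -
    obtain a b c d where q: "q = (a, b, c, d)" by (cases q)
    have "corner q \<subseteq> {..<m} \<times> {..<n}" using Q(3) that by blast
    then have "a < m" "b < n" "c < m" "d < n" by (auto simp: q corner_def)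
    from isometric_path_corner_path[OF this] show ?thesis unfolding q by auto
  qed
  moreover have "(\<Union>q\<in>Q. set (pawalk_verts (fst (corner_path q)) (snd (corner_path q))))
      = pverts (rook_graph m n)"
    unfolding pawalk_verts_corner_path image_UN[symmetric] Q(3) verts_rook_graph ..
  ultimately have "isometric_path_cover (corner_path ` Q)"
    unfolding isometric_path_cover_def by (simp add: case_prod_unfold)
  then have "isometric_path_number \<le> card (corner_path ` Q)"
    unfolding isometric_path_number_def using Q(1) by (intro Least_le) blast
  also have "\<dots> \<le> k" using card_image_le[OF Q(1), of corner_path] Q(2) by linarith
  finally show ?thesis .
qed

theorem theorem6:
  fixes n1 n2 :: nat
  assumes "n1 \<ge> 2" and "n2 \<ge> 2"
  shows "int (pre_digraph.isometric_path_number (with_proj (complete_graph_product [n1, n2])))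
           = \<lceil>real (n1 * n2) / 3\<rceil>"
proof -
  let ?k = "pre_digraph.isometric_path_number (rook_graph n1 n2)"
  have "?k \<le> (n1 * n2 + 2) div 3"
    using optimally_coverable[OF assms]
    by (intro rook_graph_isometric_path_number_le) (simp add: optimally_coverable_def)
  \<comment> \<open>Together with the lower bound this puts \<open>?k\<close> in the half-open unit
    interval starting at \<open>n1 * n2 / 3\<close>, which characterizes the ceiling.\<close>
  then have "3 * ?k < n1 * n2 + 3" by linarith
  then have "3 * real ?k < real (n1 * n2) + 3"
    by (metis of_nat_add of_nat_less_iff of_nat_mult of_nat_numeral)
  moreover have "real (n1 * n2) \<le> 3 * real ?k"
    using rook_graph_le_isometric_path_number[of n1 n2]
    by (metis of_nat_le_iff of_nat_mult of_nat_numeral)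
  ultimately show ?thesis by (intro ceiling_unique[symmetric]) auto
qed

end
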